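(* Let $\mathfrak{g}$ be a vector space over $\mathbf{k}$ with a Lie bracket $[\,,\,]$ and a linear operator $P:\mathfrak{g}\to\mathfrak{g}$, let $\lambda,\kappa\in\mathbf{k}$, and set $x\circ y:=[P(x),y]$ for $x,y\in\mathfrak{g}$. (a) If $(\mathfrak{g},[\,,\,],P)$ is a modified Rota-Baxter Lie algebra of weight $\kappa$, then $(\mathfrak{g},[\,,\,],\circ)$ is a modified post-Lie algebra of weight $\kappa$. (b) If $(\mathfrak{g},[\,,\,],P)$ is a Rota-Baxter Lie algebra of weight $\lambda$, then $(\mathfrak{g},[\,,\,],\circ)$ is a post-Lie algebra of weight $\lambda$. (c) If $(\mathfrak{g},[\,,\,],P)$ is a Rota-Baxter Lie algebra of weight $0$, then $(\mathfrak{g},[\,,\,],\circ)$ is a post-Lie algebra of weight $0$.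
   Context: $\mathbf{k}$ is a field of characteristic $0$; all operations are bilinear. An extended Rota-Baxter Lie algebra of weight $(\lambda,\kappa)$ is a vector space $\mathfrak{g}$ with a Lie bracket $[\,,\,]$ and a linear operator $P:\mathfrak{g}\to\mathfrak{g}$ such that $[P(x),P(y)]=P([P(x),y]+[x,P(y)]+\lambda[x,y])+\kappa[x,y]$ for all $x,y\in\mathfrak{g}$. A modified Rota-Baxter Lie algebra of weight $\kappa$ is the case $\lambda=0$; a Rota-Baxter Lie algebra of weight $\lambda$ is the case $\kappa=0$. An extended post-Lie algebra of weight $(\lambda,\kappa)$ is a vector space $A$ with a Lie bracket $[\,,\,]$ and a binary operation $\circ$ such that for all $x,y,z\in A$: $(x\circ y)\circ z-(y\circ x)\circ z+\lambda[x,y]\circ z+\kappa[[x,y],z]=x\circ(y\circ z)-y\circ(x\circ z)$ and $x\circ[y,z]=[x\circ y,z]+[y,x\circ z]$. A modified post-Lie algebra of weight $\kappa$ is the case $\lambda=0$; a post-Lie algebra of weight $\lambda$ is the case $\kappa=0$; a post-Lie algebra of weight $0$ is the case $\lambda=\kappa=0$. *)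

theory Defs
  imports Complex_Main
begin

definition bilinear_op ::
  "('k::field \<Rightarrow> 'g::ab_group_add \<Rightarrow> 'g) \<Rightarrow> ('g \<Rightarrow> 'g \<Rightarrow> 'g) \<Rightarrow> bool" where
  "bilinear_op scale f \<longleftrightarrow>
     (\<forall>x. Vector_Spaces.linear scale scale (\<lambda>y. f x y)) \<and>
     (\<forall>y. Vector_Spaces.linear scale scale (\<lambda>x. f x y))"

locale lie_algebra = vector_space scale
  for scale :: "'k::field_char_0 \<Rightarrow> 'g::ab_group_add \<Rightarrow> 'g" (infixr "*s" 75) +
  fixes br :: "'g \<Rightarrow> 'g \<Rightarrow> 'g"
  assumes bilinear_br: "bilinear_op scale br"
    and br_self: "br x x = 0"
    and jacobi: "br x (br y z) + br y (br z x) + br z (br x y) = 0"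

(* The weight is the pair (l, \<kappa>); l is the paper's lambda, whose symbol is reserved. *)
locale extended_rota_baxter_lie_algebra = lie_algebra scale br
  for scale :: "'k::field_char_0 \<Rightarrow> 'g::ab_group_add \<Rightarrow> 'g" (infixr "*s" 75)
    and br :: "'g \<Rightarrow> 'g \<Rightarrow> 'g" +
  fixes P :: "'g \<Rightarrow> 'g" and l \<kappa> :: 'k
  assumes linear_P: "Vector_Spaces.linear scale scale P"
    and rota_baxter:
      "br (P x) (P y) = P (br (P x) y + br x (P y) + l *s br x y) + \<kappa> *s br x y"

definition modified_rota_baxter_lie_algebra ::
  "('k::field_char_0 \<Rightarrow> 'g::ab_group_add \<Rightarrow> 'g) \<Rightarrow> ('g \<Rightarrow> 'g \<Rightarrow> 'g) \<Rightarrow> ('g \<Rightarrow> 'g) \<Rightarrow> 'k \<Rightarrow> bool" where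
  "modified_rota_baxter_lie_algebra scale br P \<kappa> \<longleftrightarrow>
     extended_rota_baxter_lie_algebra scale br P 0 \<kappa>"

definition rota_baxter_lie_algebra ::
  "('k::field_char_0 \<Rightarrow> 'g::ab_group_add \<Rightarrow> 'g) \<Rightarrow> ('g \<Rightarrow> 'g \<Rightarrow> 'g) \<Rightarrow> ('g \<Rightarrow> 'g) \<Rightarrow> 'k \<Rightarrow> bool" where
  "rota_baxter_lie_algebra scale br P l \<longleftrightarrow>
     extended_rota_baxter_lie_algebra scale br P l 0"

(* The product is bilinear by the convention that all operations are. *)
locale extended_post_lie_algebra = lie_algebra scale br
  for scale :: "'k::field_char_0 \<Rightarrow> 'g::ab_group_add \<Rightarrow> 'g" (infixr "*s" 75)
    and br :: "'g \<Rightarrow> 'g \<Rightarrow> 'g" +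
  fixes circ :: "'g \<Rightarrow> 'g \<Rightarrow> 'g" (infixl "\<bullet>" 80) and l \<kappa> :: 'k
  assumes bilinear_circ: "bilinear_op scale circ"
    and post_lie:
      "(x \<bullet> y) \<bullet> z - (y \<bullet> x) \<bullet> z + l *s (br x y \<bullet> z) + \<kappa> *s br (br x y) z
         = x \<bullet> (y \<bullet> z) - y \<bullet> (x \<bullet> z)"
    and derivation: "x \<bullet> br y z = br (x \<bullet> y) z + br y (x \<bullet> z)"

definition modified_post_lie_algebra ::
  "('k::field_char_0 \<Rightarrow> 'g::ab_group_add \<Rightarrow> 'g) \<Rightarrow> ('g \<Rightarrow> 'g \<Rightarrow> 'g) \<Rightarrow> ('g \<Rightarrow> 'g \<Rightarrow> 'g) \<Rightarrow> 'k \<Rightarrow> bool" where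
  "modified_post_lie_algebra scale br circ \<kappa> \<longleftrightarrow>
     extended_post_lie_algebra scale br circ 0 \<kappa>"

definition post_lie_algebra ::
  "('k::field_char_0 \<Rightarrow> 'g::ab_group_add \<Rightarrow> 'g) \<Rightarrow> ('g \<Rightarrow> 'g \<Rightarrow> 'g) \<Rightarrow> ('g \<Rightarrow> 'g \<Rightarrow> 'g) \<Rightarrow> 'k \<Rightarrow> bool" where
  "post_lie_algebra scale br circ l \<longleftrightarrow>
     extended_post_lie_algebra scale br circ l 0"

end

theory Submission
  imports Defs
begin

text \<open>
  All three claims are instances of one fact, valid for every weight \<open>(l, \<kappa>)\<close>: an extended
  Rota-Baxter operator \<open>P\<close> turns the Lie algebra into an extended post-Lie algebra with product
  \<open>x \<circ> y = [P x, y]\<close>, of the same weight.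

  Left multiplication by \<open>x\<close> in this product is \<open>ad (P x)\<close>. The Jacobi identity says that
  \<open>ad a\<close> is a derivation of the bracket, which is the compatibility axiom, and also that
  \<open>ad a \<circ> ad b - ad b \<circ> ad a = ad [a, b]\<close>, so that
  \<open>x \<circ> (y \<circ> z) - y \<circ> (x \<circ> z) = [[P x, P y], z]\<close>. Expanding \<open>[P x, P y]\<close> by the
  Rota-Baxter identity produces exactly the four terms on the other side of the post-Lie axiom;
  antisymmetry turns the term \<open>[P [x, P y], z]\<close> into \<open>- (y \<circ> x) \<circ> z\<close>.
\<close>

context lie_algebra
begin

lemma br_linear_left: "Vector_Spaces.linear scale scale (\<lambda>x. br x y)"
  and br_linear_right: "Vector_Spaces.linear scale scale (br x)"
  using bilinear_br by (simp_all add: bilinear_op_def)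

lemma br_add_left: "br (x + x') y = br x y + br x' y"
  and br_scale_left: "br (c *s x) y = c *s br x y"
  and br_add_right: "br x (y + y') = br x y + br x y'"
  using br_linear_left[of y] br_linear_right[of x]
  by (simp_all add: Vector_Spaces.linear_iff)

lemma br_diff_left: "br (x - x') y = br x y - br x' y"
  and br_minus_right: "br x (- y) = - br x y"
  by (rule module_hom.diff[OF module_hom_linearI[OF br_linear_left]],
      rule module_hom.neg[OF module_hom_linearI[OF br_linear_right]])

lemma br_antisym: "br y x = - br x y"
proof -
  have "br x y + br y x = (br x x + br y x) + (br x y + br y y)"
    by (simp add: br_self)
  also have "\<dots> = br (x + y) (x + y)"
    by (simp only: br_add_left br_add_right)
  also have "\<dots> = 0"
    by (rule br_self)
  finally show ?thesis
    by (simp only: add_eq_0_iff)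
qed

text \<open>The Jacobi identity read as a statement about the single operator \<open>ad a\<close>.\<close>

lemma br_derivation: "br a (br y z) = br (br a y) z + br y (br a z)"
proof -
  have "br y (br z a) = - br y (br a z)"
    by (simp add: br_antisym[of z a] br_minus_right)
  moreover have "br z (br a y) = - br (br a y) z"
    by (rule br_antisym)
  ultimately show ?thesis
    using jacobi[of a y z] by (simp add: algebra_simps)
qed

text \<open>The same identity read as: \<open>ad\<close> is a representation.\<close>

lemma br_commutator: "br a (br b z) - br b (br a z) = br (br a b) z"
  by (simp add: br_derivation[of a b z])

end

context extended_rota_baxter_lie_algebra
begin

lemma P_add: "P (x + y) = P x + P y"
  and P_scale: "P (c *s x) = c *s P x"
  using linear_P by (simp_all add: Vector_Spaces.linear_iff)

lemma P_minus: "P (- x) = - P x"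
  by (rule module_hom.neg[OF module_hom_linearI[OF linear_P]])

lemma bilinear_br_P: "bilinear_op scale (\<lambda>x y. br (P x) y)"
  using Vector_Spaces.linear_compose[OF linear_P br_linear_left]
  by (simp add: bilinear_op_def br_linear_right comp_def)

text \<open>
  Because \<open>ad\<close> is a representation, applying it to both sides of the Rota-Baxter identity gives
  the post-Lie axiom for \<open>x \<circ> y = [P x, y]\<close>.
\<close>

lemma br_P_post_lie:
  "br (P (br (P x) y)) z - br (P (br (P y) x)) z + l *s br (P (br x y)) z + \<kappa> *s br (br x y) z
     = br (P x) (br (P y) z) - br (P y) (br (P x) z)"
proof -
  have "P (br x (P y)) = - P (br (P y) x)"
    by (simp add: br_antisym[of x "P y"] P_minus)
  then have "br (P x) (P y) =
      P (br (P x) y) - P (br (P y) x) + l *s P (br x y) + \<kappa> *s br x y"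
    by (simp add: rota_baxter P_add P_scale)
  then have "br (br (P x) (P y)) z =
      br (P (br (P x) y)) z - br (P (br (P y) x)) z + l *s br (P (br x y)) z + \<kappa> *s br (br x y) z"
    by (simp only: br_add_left br_diff_left br_scale_left)
  then show ?thesis
    by (simp add: br_commutator)
qed

theorem extended_post_lie_br_P:
  "extended_post_lie_algebra scale br (\<lambda>x y. br (P x) y) l \<kappa>"
  by unfold_locales (rule bilinear_br_P br_P_post_lie br_derivation)+

end

theorem corollary2p20:
  fixes scale :: "'k::field_char_0 \<Rightarrow> 'g::ab_group_add \<Rightarrow> 'g"
    and br :: "'g \<Rightarrow> 'g \<Rightarrow> 'g" and P :: "'g \<Rightarrow> 'g" and l \<kappa> :: 'k
  assumes "lie_algebra scale br"
    and "Vector_Spaces.linear scale scale P"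
  shows "(modified_rota_baxter_lie_algebra scale br P \<kappa>
            \<longrightarrow> modified_post_lie_algebra scale br (\<lambda>x y. br (P x) y) \<kappa>) \<and>
         (rota_baxter_lie_algebra scale br P l
            \<longrightarrow> post_lie_algebra scale br (\<lambda>x y. br (P x) y) l) \<and>
         (rota_baxter_lie_algebra scale br P 0
            \<longrightarrow> post_lie_algebra scale br (\<lambda>x y. br (P x) y) 0)"
  unfolding modified_rota_baxter_lie_algebra_def rota_baxter_lie_algebra_def
    modified_post_lie_algebra_def post_lie_algebra_def
  by (simp add: extended_rota_baxter_lie_algebra.extended_post_lie_br_P)

end
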